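(* Let $A\in\mathbb{R}^{n\times n}$ be a symmetric positive definite matrix with eigenvalues $\lambda_1,\ldots,\lambda_n$ (counted with multiplicity) and corresponding eigenvectors $\underline{v}_1,\ldots,\underline{v}_n\in\mathbb{R}^n$, $A\underline{v}_j=\lambda_j\underline{v}_j$, which are orthogonal and normalized with respect to the inner product $(\underline{x},\underline{y})=\frac1n\sum_{k=1}^n x_k y_k$, i.e. $(\underline{v}_i,\underline{v}_j)=0$ for $i\neq j$ and $(\underline{v}_j,\underline{v}_j)=1$. Let $P(x)=\beta_0+\beta_1x+\cdots+\beta_m x^m$ be a polynomial with real coefficients such that the matrix $P(A)=\beta_0 I+\beta_1A+\cdots+\beta_mA^m$ is nonsingular. Then for every $\underline{b}\in\mathbb{R}^n$ the solution of $P(A)\underline{x}=\underline{b}$ is $$\underline{x}=\sum_{j=1}^n\frac{1}{P(\lambda_j)}(\underline{b},\underline{v}_j)\,\underline{v}_j,$$ and, for all $i,k\in\{1,\ldots,n\}$, $$\left(P(A)^{-1}\right)_{ik}=\sum_{j=1}^n\frac{v_{jk}}{n\,P(\lambda_j)}\,v_{ji}.$$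
   Context: The notation $v_{jk}$ denotes the $k$-th component of the $j$-th eigenvector $\underline{v}_j$. The inner product on $\mathbb{R}^n$ is the scaled one, $(\underline{x},\underline{y})=\frac1n\sum_{k=1}^n x_k y_k$. *)

theory Defs
  imports "HOL-Analysis.Analysis" "HOL-Computational_Algebra.Polynomial"
begin

definition scaled_inner :: "real ^ 'n \<Rightarrow> real ^ 'n \<Rightarrow> real" where
  "scaled_inner x y = 1 / real CARD('n) * (\<Sum>k\<in>UNIV. x $ k * y $ k)"

definition sym_pos_def :: "real ^ 'n ^ 'n \<Rightarrow> bool" where
  "sym_pos_def A \<longleftrightarrow> transpose A = A \<and> (\<forall>x. x \<noteq> 0 \<longrightarrow> x \<bullet> (A *v x) > 0)"

text \<open>The multiplication available on \<^typ>\<open>real ^ 'n ^ 'n\<close> through the type classes is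
  componentwise, so the generic power operator is not the matrix power.\<close>

primrec mat_power :: "real ^ 'n ^ 'n \<Rightarrow> nat \<Rightarrow> real ^ 'n ^ 'n" where
  "mat_power A 0 = mat 1"
| "mat_power A (Suc k) = A ** mat_power A k"

definition poly_mat :: "real poly \<Rightarrow> real ^ 'n ^ 'n \<Rightarrow> real ^ 'n ^ 'n" where
  "poly_mat P A = (\<Sum>i\<le>degree P. coeff P i *\<^sub>R mat_power A i)"

text \<open>The list of all eigenvalues with (algebraic) multiplicity is the list of roots of the
  characteristic polynomial; \<^term>\<open>mat t\<close> is \<open>t\<close> times the identity matrix.\<close>

definition eigenvalues_with_mult :: "real ^ 'n ^ 'n \<Rightarrow> ('n \<Rightarrow> real) \<Rightarrow> bool" where
  "eigenvalues_with_mult A lam \<longleftrightarrow> (\<forall>t. det (mat t - A) = (\<Prod>j\<in>UNIV. t - lam j))"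

end

theory Submission
  imports Defs
begin

text \<open>An eigenvector of \<open>A\<close> for \<open>c\<close> is an eigenvector of
  \<open>P(A)\<close> for \<open>P(c)\<close> (\<open>poly_mat_eigenvector\<close>), so
  \<open>P(A)\<close> is diagonal in the basis of the \<open>v j\<close>. Expanding \<open>b\<close>
  in this basis (\<open>scaled_orthonormal_expansion\<close>) and dividing each coefficient by
  \<open>P(lam j)\<close> solves the system; invertibility makes the solution unique and every
  \<open>P(lam j)\<close> nonzero. Unit vectors as right-hand sides then give the entries of the
  inverse.\<close>

lemma mat_power_eigenvector:
  assumes "A *v x = c *\<^sub>R x"
  shows "mat_power A k *v x = c ^ k *\<^sub>R x"
  using assms
  by (induction k)
     (simp_all add: matrix_vector_mul_assoc [symmetric] matrix_vector_mult_scaleR mult.commute)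

lemma sum_matrix_vector_mult:
  fixes M :: "'i \<Rightarrow> real ^ 'n ^ 'm"
  shows "(\<Sum>i\<in>I. M i) *v x = (\<Sum>i\<in>I. M i *v x)"
  by (induction I rule: infinite_finite_induct)
     (simp_all add: matrix_vector_mult_add_rdistrib)

lemma poly_mat_eigenvector:
  assumes "A *v x = c *\<^sub>R x"
  shows "poly_mat P A *v x = poly P c *\<^sub>R x"
  by (simp add: poly_mat_def sum_matrix_vector_mult scaleR_matrix_vector_assoc [symmetric]
      mat_power_eigenvector [OF assms] poly_altdef scaleR_sum_left)

text \<open>Orthonormality says that the matrix with rows \<open>v j\<close> has a scaled transpose as right
  inverse; this is also a left inverse, which is the completeness relation.\<close>

lemma scaled_orthonormal_completeness:
  fixes v :: "'n \<Rightarrow> real ^ 'n"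
  assumes orth: "\<And>i j. i \<noteq> j \<Longrightarrow> scaled_inner (v i) (v j) = 0"
    and norm: "\<And>j. scaled_inner (v j) (v j) = 1"
  shows "(\<Sum>j\<in>UNIV. v j $ i * v j $ k) = (if i = k then real CARD('n) else 0)"
proof -
  define V :: "real ^ 'n ^ 'n" where "V = (\<chi> j. v j)"
  define W :: "real ^ 'n ^ 'n" where "W = (\<chi> k j. v j $ k / real CARD('n))"
  have "(V ** W) $ i $ j = (mat 1 :: real ^ 'n ^ 'n) $ i $ j" for i j
  proof -
    have "(V ** W) $ i $ j = scaled_inner (v i) (v j)"
      by (simp add: V_def W_def matrix_matrix_mult_def scaled_inner_def sum_divide_distrib)
    then show ?thesis
      by (simp add: mat_def orth norm)
  qed
  then have "V ** W = mat 1"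
    by (simp add: vec_eq_iff)
  then have "W ** V = mat 1"
    by (simp add: matrix_left_right_inverse)
  then have "(W ** V) $ i $ k = (if i = k then 1 else 0)"
    by (simp add: mat_def)
  moreover have "(W ** V) $ i $ k = (\<Sum>j\<in>UNIV. v j $ i * v j $ k) / real CARD('n)"
    by (simp add: V_def W_def matrix_matrix_mult_def sum_divide_distrib)
  ultimately show ?thesis
    by (simp add: field_simps split: if_splits)
qed

text \<open>Read componentwise and with the two sums exchanged, the inner sum over \<open>j\<close>
  is the completeness relation, which singles out the component \<open>b $ i\<close>.\<close>

lemma scaled_orthonormal_expansion:
  fixes v :: "'n \<Rightarrow> real ^ 'n"
  assumes "\<And>i j. i \<noteq> j \<Longrightarrow> scaled_inner (v i) (v j) = 0"
    and "\<And>j. scaled_inner (v j) (v j) = 1"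
  shows "(\<Sum>j\<in>UNIV. scaled_inner b (v j) *\<^sub>R v j) = b"
proof -
  have "(\<Sum>j\<in>UNIV. scaled_inner b (v j) *\<^sub>R v j) $ i = b $ i" for i
  proof -
    have "(\<Sum>j\<in>UNIV. scaled_inner b (v j) *\<^sub>R v j) $ i
        = (\<Sum>j\<in>UNIV. \<Sum>k\<in>UNIV. b $ k * (v j $ k * v j $ i) / real CARD('n))"
      by (simp add: scaled_inner_def sum_distrib_right sum_divide_distrib mult.assoc)
    also have "\<dots> = (\<Sum>k\<in>UNIV. b $ k * (\<Sum>j\<in>UNIV. v j $ k * v j $ i) / real CARD('n))"
      by (subst sum.swap) (simp add: sum_distrib_left sum_divide_distrib)
    also have "\<dots> = (\<Sum>k\<in>UNIV. if k = i then b $ k else 0)"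
      by (intro sum.cong) (simp_all add: scaled_orthonormal_completeness [OF assms])
    also have "\<dots> = b $ i"
      by simp
    finally show ?thesis .
  qed
  then show ?thesis
    by (simp add: vec_eq_iff)
qed

text \<open>The source of the factor \<open>1/n\<close> in the formula for the entries of the
  inverse.\<close>

lemma scaled_inner_axis:
  fixes y :: "real ^ 'n"
  shows "scaled_inner (axis k 1) y = y $ k / real CARD('n)"
proof -
  have "(\<Sum>i\<in>UNIV. axis k 1 $ i * y $ i) = y $ k"
    using inner_axis' [of k 1 y] by (simp add: inner_vec_def)
  then show ?thesis
    by (simp add: scaled_inner_def)
qed

text \<open>Gives uniqueness of the solution, and lets a solution found for each right-hand side be
  read as the action of the inverse.\<close>

lemma invertible_matrix_vector_eq_iff:
  fixes M :: "real ^ 'n ^ 'n"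
  assumes "invertible M"
  shows "M *v x = b \<longleftrightarrow> x = matrix_inv M *v b"
proof -
  \<comment> \<open>\<open>matrix_inv\<close> is defined by choice; invertibility supplies the
    witness.\<close>
  have "M ** matrix_inv M = mat 1 \<and> matrix_inv M ** M = mat 1"
    using assms unfolding invertible_def matrix_inv_def by (rule someI_ex)
  then show ?thesis
    by (metis matrix_vector_mul_assoc matrix_vector_mul_lid)
qed

theorem mainTheorem2:
  fixes A :: "real ^ 'n ^ 'n"
    and lam :: "'n \<Rightarrow> real"
    and v :: "'n \<Rightarrow> real ^ 'n"
    and P :: "real poly"
  assumes "sym_pos_def A"
    and "eigenvalues_with_mult A lam"
    and "\<And>j. A *v v j = lam j *\<^sub>R v j"
    and "\<And>i j. i \<noteq> j \<Longrightarrow> scaled_inner (v i) (v j) = 0"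
    and "\<And>j. scaled_inner (v j) (v j) = 1"
    and "invertible (poly_mat P A)"
  shows "(\<forall>j. poly P (lam j) \<noteq> 0) \<and>
    (\<forall>b x. poly_mat P A *v x = b \<longleftrightarrow>
       x = (\<Sum>j\<in>UNIV. (1 / poly P (lam j) * scaled_inner b (v j)) *\<^sub>R v j)) \<and>
    (\<forall>i k. matrix_inv (poly_mat P A) $ i $ k =
       (\<Sum>j\<in>UNIV. v j $ k / (real CARD('n) * poly P (lam j)) * v j $ i))"
proof -
  let ?M = "poly_mat P A"
  define S where
    "S b = (\<Sum>j\<in>UNIV. (1 / poly P (lam j) * scaled_inner b (v j)) *\<^sub>R v j)" for b
  have M_v: "?M *v v j = poly P (lam j) *\<^sub>R v j" for j
    by (rule poly_mat_eigenvector) (rule assms(3))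
  have nz: "poly P (lam j) \<noteq> 0" for j
  proof
    assume "poly P (lam j) = 0"
    \<comment> \<open>\<open>?M\<close> would send \<open>v j\<close> to 0, and an invertible matrix
      has trivial kernel; this contradicts normalization.\<close>
    then have "v j = 0"
      using M_v [of j] invertible_matrix_vector_eq_iff [OF assms(6), of "v j" 0] by simp
    with assms(5) [of j] show False
      by (simp add: scaled_inner_def)
  qed
  have "?M *v S b = b" for b
  proof -
    \<comment> \<open>Each eigenvalue \<open>P(lam j)\<close> of \<open>?M\<close> cancels the
      denominator in \<open>S b\<close>, leaving the expansion of \<open>b\<close>.\<close>
    have "?M *v S b = (\<Sum>j\<in>UNIV. scaled_inner b (v j) *\<^sub>R v j)"
      by (simp add: S_def linear_sum [OF matrix_vector_mul_linear] matrix_vector_mult_scaleR M_v nz)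
    then show ?thesis
      using scaled_orthonormal_expansion [OF assms(4,5)] by simp
  qed
  then have inv_S: "matrix_inv ?M *v b = S b" for b
    using invertible_matrix_vector_eq_iff [OF assms(6)] by metis
  have "matrix_inv ?M $ i $ k
      = (\<Sum>j\<in>UNIV. v j $ k / (real CARD('n) * poly P (lam j)) * v j $ i)" for i k
  proof -
    \<comment> \<open>Column \<open>k\<close> of a matrix is its image of the \<open>k\<close>-th
      unit vector.\<close>
    have "matrix_inv ?M $ i $ k = S (axis k 1) $ i"
      using inv_S [of "axis k 1"] by (simp add: matrix_vector_mult_basis column_def vec_eq_iff)
    then show ?thesis
      by (simp add: S_def scaled_inner_axis mult.commute)
  qed
  then show ?thesis
    using nz invertible_matrix_vector_eq_iff [OF assms(6)] by (simp add: inv_S S_def)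
qed

end
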